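(* Let $g:\mathbb{R}\to[0,\infty)$ be a probability density function whose associated generator $(g_k)_{k\in\mathbb{Z}}$, $g_k(u)= g(k+u)$ for $u\in[0,1)$, is uniform, and let $Y$ be a real random variable with pdf $g$. Then $\langle Y\rangle$ is uniformly distributed on $[0,1)$, and consequently, for every real $b>1$, the random variable $b^Y$ is $b$-Benford.
   Context: For $y\in\mathbb{R}$, $\langle y\rangle = y-\lfloor y\rfloor\in[0,1)$ denotes the fractional part of $y$. A generator is a family of functions $(g_k)_{k\in\mathbb{Z}}$, each mapping $[0,1)$ into $[0,\infty)$. A generator is uniform if $\sum_{k\in\mathbb{Z}} g_k(u)=1$ for all $u\in[0,1)$, where the convergence of this series of functions of $u$ is uniform on $[0,1)$. The generator associated with $g:\mathbb{R}\to[0,\infty)$ is given by $g_k(u)=g(k+u)$ for $k\in\mathbb{Z}$, $u\in[0,1)$. For $b>1$ and $x>0$, the base $b$ significand $S_b(x)$ is the unique $s\in[1,b)$ such that $x=s\,b^k$ for some $k\in\mathbb{Z}$. A positive continuous random variable $X$ (with a pdf) is $b$-Benford if $\Pr(S_b(X)\le s)=\log_b(s)$ for all $s\in[1,b)$; equivalently, $\langle\log_b(X)\rangle$ is uniformly distributed on $[0,1)$. *)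

theory Defs
  imports "HOL-Probability.Probability"
begin

definition generator :: "(int \<Rightarrow> real \<Rightarrow> real) \<Rightarrow> bool" where
  "generator h \<longleftrightarrow> (\<forall>k. \<forall>u\<in>{0..<1}. 0 \<le> h k u)"

text \<open>The family is indexed by all integers, so its sum is taken along the net of finite index
  sets, as in \<^const>\<open>has_sum\<close>, but uniformly in \<open>u\<close>. The terms being nonnegative, this agrees with
  uniform convergence of the partial sums over \<open>{-n..n}\<close>, or over \<open>{-m..n}\<close>.\<close>

definition uniform_generator :: "(int \<Rightarrow> real \<Rightarrow> real) \<Rightarrow> bool" where
  "uniform_generator h \<longleftrightarrow> generator h \<and>
     uniform_limit {0..<1} (\<lambda>K u. \<Sum>k\<in>K. h k u) (\<lambda>u. 1) (finite_subsets_at_top UNIV)"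

definition assoc_generator :: "(real \<Rightarrow> real) \<Rightarrow> int \<Rightarrow> real \<Rightarrow> real" where
  "assoc_generator g k u = g (of_int k + u)"

definition prob_density :: "(real \<Rightarrow> real) \<Rightarrow> bool" where
  "prob_density f \<longleftrightarrow> f \<in> borel_measurable borel \<and> (\<forall>x. 0 \<le> f x) \<and>
     (\<integral>\<^sup>+ x. ennreal (f x) \<partial>lborel) = 1"

definition significand :: "real \<Rightarrow> real \<Rightarrow> real" where
  "significand b x = (THE s. s \<in> {1..<b} \<and> (\<exists>k::int. x = s * b powi k))"

lemma significand_ex1:
  fixes b x :: real
  assumes b: "1 < b" and x: "0 < x"
  shows "\<exists>!s. s \<in> {1..<b} \<and> (\<exists>k::int. x = s * b powi k)"
proof (rule ex_ex1I)
  define k where "k = \<lfloor>log b x\<rfloor>"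
  have "of_int k \<le> log b x" "log b x < of_int k + 1"
    unfolding k_def by linarith+
  then have "b powr of_int k \<le> x" "x < b powr (of_int k + 1)"
    using b x by (simp_all add: le_log_iff log_less_iff)
  then have "b powi k \<le> x" "x < b * b powi k"
    using b by (simp_all add: powr_add powr_real_of_int' mult.commute)
  moreover have "0 < b powi k" using b by simp
  ultimately have "x / b powi k \<in> {1..<b} \<and> x = x / b powi k * b powi k"
    using b by (simp add: field_simps)
  then show "\<exists>s. s \<in> {1..<b} \<and> (\<exists>k::int. x = s * b powi k)" by blast
next
  have log_floor: "\<lfloor>log b x\<rfloor> = k" if s: "s \<in> {1..<b}" and k: "x = s * b powi k" for s k
  proof -
    have "x = s * b powr of_int k" using b k by (simp add: powr_real_of_int')
    then have "log b x = log b s + of_int k" using b s by (simp add: log_mult)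
    moreover have "0 \<le> log b s" "log b s < 1" using b s by auto
    ultimately show ?thesis by linarith
  qed
  fix s t
  assume "s \<in> {1..<b} \<and> (\<exists>k::int. x = s * b powi k)" "t \<in> {1..<b} \<and> (\<exists>k::int. x = t * b powi k)"
  then obtain k l where "s \<in> {1..<b}" "x = s * b powi k" "t \<in> {1..<b}" "x = t * b powi l" by blast
  moreover from this have "k = l" using log_floor by metis
  ultimately show "s = t" using b by simp
qed

definition (in prob_space) benford :: "real \<Rightarrow> ('a \<Rightarrow> real) \<Rightarrow> bool" where
  "benford b X \<longleftrightarrow>
     (\<forall>\<omega>\<in>space M. 0 < X \<omega>) \<and>
     (\<exists>f. prob_density f \<and> distributed M lborel X (\<lambda>x. ennreal (f x))) \<and>
     (\<forall>s\<in>{1..<b}. \<P>(\<omega> in M. significand b (X \<omega>) \<le> s) = log b s)"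

end

theory Submission
  imports Defs
begin

text \<open>Over a point \<open>u\<close> of \<open>[0,1)\<close>, the map \<^const>\<open>frac\<close> has the fibre of all \<open>k + u\<close> with \<open>k\<close> an
  integer. Hence, if \<open>Y\<close> has density \<open>g\<close>, the density of \<open>frac Y\<close> at \<open>u\<close> is the sum of \<open>g (k + u)\<close>
  over all \<open>k\<close>, which is the generator sum and equals 1. The folding identity
  \<open>nn_integral_lborel_fold\<close> makes this rigorous: all terms are nonnegative, so sum and integral may
  be exchanged. This gives \<open>distributed_frac_uniform\<close>.

  Writing \<open>Y\<close> as its integer part plus its fractional part shows that \<open>b powr Y\<close> has significand
  \<open>b powr frac Y\<close> (\<open>significand_powr\<close>). This is at most \<open>s\<close> exactly if \<open>frac Y \<le> log b s\<close>, an event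
  of probability \<open>log b s\<close> by uniformity. That \<open>b powr Y\<close> is itself continuous is a change of
  variables (\<open>distributed_powr\<close>).\<close>

section \<open>Folding the real line onto the unit interval\<close>

text \<open>The generator hypothesis is about unordered real sums, whereas interchanging sum and
  integral is done by Tonelli for the counting measure. The two meet because a summable
  nonnegative family is absolutely summable.\<close>

lemma nn_integral_count_space_has_sum:
  fixes f :: "'i \<Rightarrow> real"
  assumes nonneg: "\<And>i. i \<in> A \<Longrightarrow> 0 \<le> f i" and sum: "(f has_sum s) A"
  shows "(\<integral>\<^sup>+i. ennreal (f i) \<partial>count_space A) = ennreal s"
proof -
  have "f summable_on A" using sum by (auto simp: summable_on_def)
  then have "(\<lambda>i. norm (f i)) summable_on A"
    using nonneg by (subst summable_on_cong[where g = f]) auto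
  then have "Infinite_Set_Sum.abs_summable_on f A"
    by (simp only: abs_summable_equivalent)
  then have "infsetsum f A = s" and "(\<integral>\<^sup>+i. ennreal (f i) \<partial>count_space A) = ennreal (infsetsum f A)"
    using sum nonneg by (simp_all add: infsetsum_infsum infsumI nn_integral_conv_infsetsum)
  then show ?thesis by simp
qed

lemma nn_integral_assoc_generator:
  assumes nonneg: "\<And>x. 0 \<le> g x" and unif: "uniform_generator (assoc_generator g)"
    and u: "u \<in> {0..<1}"
  shows "(\<integral>\<^sup>+k. ennreal (g (of_int k + u)) \<partial>count_space UNIV) = 1"
proof -
  have "uniform_limit {0..<1} (\<lambda>K u. \<Sum>k\<in>K. g (of_int k + u)) (\<lambda>u. 1) (finite_subsets_at_top UNIV)"
    using unif by (simp add: uniform_generator_def assoc_generator_def)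
  from tendsto_uniform_limitI[OF this u]
  have "((\<lambda>k::int. g (of_int k + u)) has_sum 1) UNIV"
    by (simp add: has_sum_def)
  from nn_integral_count_space_has_sum[OF _ this] nonneg show ?thesis by simp
qed

text \<open>The line is the disjoint union of the translates by integers of \<open>[0,1)\<close>, so translation
  invariance turns an integral over the line into an integral over \<open>[0,1)\<close> of a sum over the fibres
  of \<^const>\<open>frac\<close>.\<close>

lemma nn_integral_lborel_fold:
  fixes f :: "real \<Rightarrow> ennreal"
  assumes [measurable]: "f \<in> borel_measurable borel"
  shows "(\<integral>\<^sup>+x. f x \<partial>lborel) =
    (\<integral>\<^sup>+u. (\<integral>\<^sup>+k. f (of_int k + u) \<partial>count_space (UNIV :: int set)) * indicator {0..<1} u \<partial>lborel)"
proof -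
  have "(\<integral>\<^sup>+x. f x \<partial>lborel) =
      (\<integral>\<^sup>+x. \<integral>\<^sup>+k. f x * indicator {of_int k..<of_int k + 1} x \<partial>count_space (UNIV :: int set) \<partial>lborel)"
  proof (intro nn_integral_cong)
    fix x :: real
    (* Only the block with k equal to the floor of x contributes. *)
    have "(\<integral>\<^sup>+k. f x * indicator {of_int k..<of_int k + 1} x \<partial>count_space (UNIV :: int set)) =
        (\<Sum>k\<in>{\<lfloor>x\<rfloor>}. f x * indicator {of_int k..<of_int k + 1} x)"
      by (intro nn_integral_count_space') (auto split: split_indicator, linarith)
    also have "\<dots> = f x" by (auto split: split_indicator)
    finally show "f x = (\<integral>\<^sup>+k. f x * indicator {of_int k..<of_int k + 1} x \<partial>count_space (UNIV :: int set))"
      by simp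
  qed
  also have "\<dots> = (\<integral>\<^sup>+k. \<integral>\<^sup>+x. f x * indicator {of_int k..<of_int k + 1} x \<partial>lborel \<partial>count_space (UNIV :: int set))"
    by (intro nn_integral_count_space_nn_integral) auto
  also have "\<dots> = (\<integral>\<^sup>+k. \<integral>\<^sup>+u. f (of_int k + u) * indicator {0..<1} u \<partial>lborel \<partial>count_space (UNIV :: int set))"
  proof (rule nn_integral_cong)
    fix k :: int
    show "(\<integral>\<^sup>+x. f x * indicator {of_int k..<of_int k + 1} x \<partial>lborel) =
        (\<integral>\<^sup>+u. f (of_int k + u) * indicator {0..<1} u \<partial>lborel)"
      by (subst nn_integral_real_affine[where c = 1 and t = "of_int k"])
         (auto intro!: nn_integral_cong split: split_indicator)
  qed
  also have "\<dots> = (\<integral>\<^sup>+u. \<integral>\<^sup>+k. f (of_int k + u) * indicator {0..<1} u \<partial>count_space (UNIV :: int set) \<partial>lborel)"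
    by (intro nn_integral_count_space_nn_integral[symmetric]) auto
  finally show ?thesis by (simp add: nn_integral_multc)
qed

text \<open>In the folded integral of \<open>g\<close> over a set of the form \<open>frac -` A\<close>, the indicator is constant on
  each fibre, so the sum over the fibre is just the generator sum, which is 1.\<close>

lemma distributed_frac_uniform:
  assumes g: "prob_density g" "uniform_generator (assoc_generator g)"
    and Y: "distributed M lborel Y (\<lambda>x. ennreal (g x))"
  shows "distributed M lborel (\<lambda>\<omega>. frac (Y \<omega>)) (indicator {0..<1})"
proof -
  have [measurable]: "Y \<in> borel_measurable M" using distributed_measurable[OF Y] by simp
  have g_meas[measurable]: "g \<in> borel_measurable borel" and nonneg: "\<And>x. 0 \<le> g x"
    using g(1) by (auto simp: prob_density_def)
  have frac_meas[measurable]: "(frac :: real \<Rightarrow> real) \<in> borel_measurable borel"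
    unfolding frac_def by measurable
  have fracY[measurable]: "(\<lambda>\<omega>. frac (Y \<omega>)) \<in> borel_measurable M" by measurable
  have "distr M lborel (\<lambda>\<omega>. frac (Y \<omega>)) = density lborel (indicator {0..<1})"
  proof (rule measure_eqI)
    fix A assume "A \<in> sets (distr M lborel (\<lambda>\<omega>. frac (Y \<omega>)))"
    then have A[measurable]: "A \<in> sets borel" by simp
    have vimage_meas: "frac -` A \<in> sets lborel"
      using measurable_sets_borel[OF frac_meas A] by simp
    have "emeasure (distr M lborel (\<lambda>\<omega>. frac (Y \<omega>))) A =
        emeasure M (Y -` (frac -` A) \<inter> space M)"
      by (subst emeasure_distr) (auto simp: vimage_def)
    also have "\<dots> = (\<integral>\<^sup>+x. ennreal (g x) * indicator (frac -` A) x \<partial>lborel)"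
      by (intro distributed_emeasure[OF Y] vimage_meas)
    also have "\<dots> = (\<integral>\<^sup>+x. ennreal (g x) * indicator A (frac x) \<partial>lborel)"
      by (simp add: indicator_def)
    also have "\<dots> = (\<integral>\<^sup>+u. (\<integral>\<^sup>+k. ennreal (g (of_int k + u)) * indicator A (frac (of_int k + u))
        \<partial>count_space (UNIV :: int set)) * indicator {0..<1} u \<partial>lborel)"
      by (rule nn_integral_lborel_fold) measurable
    also have "\<dots> = (\<integral>\<^sup>+u. indicator {0..<1} u * indicator A u \<partial>lborel)"
    proof (intro nn_integral_cong)
      fix u :: real
      show "(\<integral>\<^sup>+k. ennreal (g (of_int k + u)) * indicator A (frac (of_int k + u))
          \<partial>count_space (UNIV :: int set)) * indicator {0..<1} u = indicator {0..<1} u * indicator A u"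
      proof (cases "u \<in> {0..<1}")
        case True
        then have "frac (of_int k + u) = u" for k :: int
          by (simp add: frac_unique_iff)
        then show ?thesis
          using nn_integral_assoc_generator[OF nonneg g(2) True] True by (simp add: nn_integral_multc)
      qed simp
    qed
    also have "\<dots> = emeasure (density lborel (indicator {0..<1})) A"
      by (simp add: emeasure_density)
    finally show "emeasure (distr M lborel (\<lambda>\<omega>. frac (Y \<omega>))) A =
        emeasure (density lborel (indicator {0..<1})) A" .
  qed simp
  then show ?thesis using fracY by (simp add: distributed_def)
qed

section \<open>Real powers of a base and their significands\<close>

text \<open>Substitution along \<open>y \<mapsto> b powr y\<close> is available on compact intervals; the symmetric intervals
  \<open>[-n-1, n+1]\<close> exhaust the line and their images exhaust the positive half-line, so monotone
  convergence yields the global formula.\<close>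

lemma nn_integral_powr_substitution:
  fixes F :: "real \<Rightarrow> ennreal"
  assumes b: "1 < b" and [measurable]: "F \<in> borel_measurable borel"
  shows "(\<integral>\<^sup>+x. F x * indicator {0<..} x \<partial>lborel) =
    (\<integral>\<^sup>+y. F (b powr y) * ennreal (b powr y * ln b) \<partial>lborel)"
proof -
  (* Suc n rather than n, because the substitution rule needs a nondegenerate interval. *)
  define I where "I n = {b powr - real (Suc n)..b powr real (Suc n)}" for n
  have cover: "(SUP n. indicator {- real (Suc n)..real (Suc n)} y :: ennreal) = 1" for y
  proof -
    obtain n where "\<bar>y\<bar> \<le> real n" using real_arch_simple by blast
    then have "(1::ennreal) \<le> (SUP n. indicator {- real (Suc n)..real (Suc n)} y)"
      by (intro SUP_upper2[where i = n]) (auto simp: indicator_def)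
    moreover have "(SUP n. indicator {- real (Suc n)..real (Suc n)} y :: ennreal) \<le> 1"
      by (intro SUP_least) (auto split: split_indicator)
    ultimately show ?thesis by (rule antisym[rotated])
  qed
  have I_iff: "x \<in> I n \<longleftrightarrow> 0 < x \<and> log b x \<in> {- real (Suc n)..real (Suc n)}" for x n
  proof (cases "0 < x")
    case True
    then show ?thesis unfolding I_def using b by (simp add: le_log_iff log_le_iff)
  next
    case False
    moreover have "0 < b powr - real (Suc n)" using b by simp
    ultimately have "\<not> b powr - real (Suc n) \<le> x" by linarith
    then show ?thesis unfolding I_def using False by simp
  qed
  have cover_pos: "(SUP n. indicator (I n) x :: ennreal) = indicator {0<..} x" for x
  proof (cases "0 < x")
    case True
    then have "(indicator (I n) x :: ennreal) = indicator {- real (Suc n)..real (Suc n)} (log b x)" for n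
      by (simp add: I_iff indicator_def)
    then show ?thesis using cover[of "log b x"] True by simp
  qed (simp add: I_iff)
  have mono: "I m \<subseteq> I n" if "m \<le> n" for m n
    using that by (auto simp: I_iff)
  have [measurable]: "I n \<in> sets borel" for n
    unfolding I_def by simp
  have "(\<integral>\<^sup>+x. F x * indicator {0<..} x \<partial>lborel) = (\<integral>\<^sup>+x. (SUP n. F x * indicator (I n) x) \<partial>lborel)"
    by (simp add: SUP_mult_left_ennreal[symmetric] cover_pos)
  also have "\<dots> = (SUP n. \<integral>\<^sup>+x. F x * indicator (I n) x \<partial>lborel)"
    by (intro nn_integral_monotone_convergence_SUP)
      (auto simp: incseq_def le_fun_def intro!: mult_left_mono dest: subsetD[OF mono]
        split: split_indicator)
  also have "\<dots> = (SUP n. \<integral>\<^sup>+y. F (b powr y) * ennreal (b powr y * ln b) *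
      indicator {- real (Suc n)..real (Suc n)} y \<partial>lborel)"
    unfolding I_def using b
    by (intro SUP_cong refl nn_integral_substitution_aux)
       (auto intro!: derivative_eq_intros continuous_intros)
  also have "\<dots> = (\<integral>\<^sup>+y. (SUP n. F (b powr y) * ennreal (b powr y * ln b) *
      indicator {- real (Suc n)..real (Suc n)} y) \<partial>lborel)"
    by (intro nn_integral_monotone_convergence_SUP[symmetric])
      (auto simp: incseq_def le_fun_def intro!: mult_left_mono split: split_indicator)
  also have "\<dots> = (\<integral>\<^sup>+y. F (b powr y) * ennreal (b powr y * ln b) \<partial>lborel)"
    by (simp only: SUP_mult_left_ennreal[symmetric] cover mult_1_right)
  finally show ?thesis .
qed

text \<open>Being Benford includes having a density. For \<open>b powr Y\<close> it is \<open>g\<close> composed with the inverse map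
  \<open>log b\<close>, times the derivative \<open>1 / (x * ln b)\<close> of that inverse.\<close>

lemma distributed_powr:
  assumes b: "1 < b" and g: "prob_density g"
    and Y: "distributed M lborel Y (\<lambda>x. ennreal (g x))"
  defines "f \<equiv> \<lambda>x. if 0 < x then g (log b x) / (x * ln b) else 0"
  shows "prob_density f" and "distributed M lborel (\<lambda>\<omega>. b powr Y \<omega>) (\<lambda>x. ennreal (f x))"
proof -
  have [measurable]: "Y \<in> borel_measurable M" using distributed_measurable[OF Y] by simp
  have [measurable]: "g \<in> borel_measurable borel" and nonneg: "\<And>x. 0 \<le> g x"
    and total: "(\<integral>\<^sup>+x. ennreal (g x) \<partial>lborel) = 1"
    using g by (auto simp: prob_density_def)
  have powr_meas: "(\<lambda>y. b powr y) \<in> borel_measurable borel" by measurable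
  have powrY[measurable]: "(\<lambda>\<omega>. b powr Y \<omega>) \<in> borel_measurable M" by measurable
  have f_meas[measurable]: "f \<in> borel_measurable borel" unfolding f_def by measurable
  have f_nonneg: "0 \<le> f x" for x using b nonneg by (simp add: f_def)
  have cov: "(\<integral>\<^sup>+x. ennreal (f x) * indicator A x \<partial>lborel) =
      (\<integral>\<^sup>+y. ennreal (g y) * indicator A (b powr y) \<partial>lborel)"
    if [measurable]: "A \<in> sets borel" for A
  proof -
    have "(\<integral>\<^sup>+x. ennreal (f x) * indicator A x \<partial>lborel) =
        (\<integral>\<^sup>+x. ennreal (f x) * indicator A x * indicator {0<..} x \<partial>lborel)"
      by (intro nn_integral_cong) (auto simp: f_def split: split_indicator)
    also have "\<dots> = (\<integral>\<^sup>+y. ennreal (f (b powr y)) * indicator A (b powr y) *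
        ennreal (b powr y * ln b) \<partial>lborel)"
      using b by (intro nn_integral_powr_substitution) auto
    also have "\<dots> = (\<integral>\<^sup>+y. ennreal (g y) * indicator A (b powr y) \<partial>lborel)"
    proof (intro nn_integral_cong)
      fix y
      have "f (b powr y) * (b powr y * ln b) = g y" using b by (simp add: f_def)
      moreover have "0 \<le> f (b powr y)" using b nonneg by (simp add: f_def)
      ultimately have "ennreal (f (b powr y)) * ennreal (b powr y * ln b) = ennreal (g y)"
        by (metis ennreal_mult')
      then show "ennreal (f (b powr y)) * indicator A (b powr y) * ennreal (b powr y * ln b) =
          ennreal (g y) * indicator A (b powr y)"
        by (metis mult.assoc mult.commute)
    qed
    finally show ?thesis .
  qed
  show "prob_density f"
    using cov[of UNIV] total f_nonneg by (auto simp: prob_density_def)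
  have "distr M lborel (\<lambda>\<omega>. b powr Y \<omega>) = density lborel (\<lambda>x. ennreal (f x))"
  proof (rule measure_eqI)
    fix A assume "A \<in> sets (distr M lborel (\<lambda>\<omega>. b powr Y \<omega>))"
    then have A[measurable]: "A \<in> sets borel" by simp
    have vimage_meas: "(\<lambda>y. b powr y) -` A \<in> sets lborel"
      using measurable_sets_borel[OF powr_meas A] by simp
    have "emeasure (distr M lborel (\<lambda>\<omega>. b powr Y \<omega>)) A =
        emeasure M (Y -` ((\<lambda>y. b powr y) -` A) \<inter> space M)"
      by (subst emeasure_distr) (auto simp: vimage_def)
    also have "\<dots> = (\<integral>\<^sup>+y. ennreal (g y) * indicator ((\<lambda>y. b powr y) -` A) y \<partial>lborel)"
      by (intro distributed_emeasure[OF Y] vimage_meas)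
    also have "\<dots> = (\<integral>\<^sup>+y. ennreal (g y) * indicator A (b powr y) \<partial>lborel)"
      by (simp add: indicator_def)
    also have "\<dots> = emeasure (density lborel (\<lambda>x. ennreal (f x))) A"
      by (simp add: emeasure_density cov)
    finally show "emeasure (distr M lborel (\<lambda>\<omega>. b powr Y \<omega>)) A =
        emeasure (density lborel (\<lambda>x. ennreal (f x))) A" .
  qed simp
  then show "distributed M lborel (\<lambda>\<omega>. b powr Y \<omega>) (\<lambda>x. ennreal (f x))"
    using powrY by (simp add: distributed_def)
qed

text \<open>The integer part of the exponent is absorbed by the integer power of \<open>b\<close>. This links
  significands to fractional parts.\<close>

lemma significand_powr:
  assumes b: "1 < b"
  shows "significand b (b powr y) = b powr frac y"
  unfolding significand_def
proof (rule the1_equality[OF significand_ex1])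
  have "b powr frac y < b powr 1" using b frac_lt_1 by (intro powr_less_mono) auto
  moreover have "1 \<le> b powr frac y" using b by (simp add: ge_one_powr_ge_zero)
  moreover have "b powr y = b powr frac y * b powi \<lfloor>y\<rfloor>"
    using b by (simp add: powr_real_of_int'[symmetric] powr_add[symmetric] frac_def)
  ultimately show "b powr frac y \<in> {1..<b} \<and> (\<exists>k::int. b powr y = b powr frac y * b powi k)"
    using b by auto
qed (use b in auto)

lemma benford_powr:
  assumes b: "1 < b" and M: "prob_space M" and g: "prob_density g"
    and Y: "distributed M lborel Y (\<lambda>x. ennreal (g x))"
    and frac: "distributed M lborel (\<lambda>\<omega>. frac (Y \<omega>)) (indicator {0..<1})"
  shows "prob_space.benford M b (\<lambda>\<omega>. b powr Y \<omega>)"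
proof -
  interpret prob_space M by (rule M)
  have "\<P>(\<omega> in M. significand b (b powr Y \<omega>) \<le> s) = log b s" if s: "s \<in> {1..<b}" for s
  proof -
    have log_s: "0 \<le> log b s" "log b s < 1" using b s by auto
    have "{\<omega> \<in> space M. significand b (b powr Y \<omega>) \<le> s} =
        (\<lambda>\<omega>. frac (Y \<omega>)) -` {..log b s} \<inter> space M"
      using b s by (auto simp: significand_powr le_log_iff)
    then have "emeasure M {\<omega> \<in> space M. significand b (b powr Y \<omega>) \<le> s} =
        (\<integral>\<^sup>+x. indicator {0..<1} x * indicator {..log b s} x \<partial>lborel)"
      using distributed_emeasure[OF frac, of "{..log b s}"] by simp
    also have "\<dots> = (\<integral>\<^sup>+x. indicator {0..log b s} x \<partial>lborel)"
      using log_s by (intro nn_integral_cong) (auto split: split_indicator)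
    also have "\<dots> = ennreal (log b s)" using log_s by simp
    finally show ?thesis using log_s by (simp add: measure_def)
  qed
  then show ?thesis
    using b distributed_powr[OF b g Y] unfolding benford_def by auto
qed

theorem mainTheorem1:
  fixes g :: "real \<Rightarrow> real" and M :: "'a measure" and Y :: "'a \<Rightarrow> real"
  assumes "prob_density g"
    and "uniform_generator (assoc_generator g)"
    and "prob_space M"
    and "distributed M lborel Y (\<lambda>x. ennreal (g x))"
  shows "distributed M lborel (\<lambda>\<omega>. frac (Y \<omega>))
           (\<lambda>x. indicator {0..<1} x / measure lborel {0..<1::real})
       \<and> (\<forall>b>1. prob_space.benford M b (\<lambda>\<omega>. b powr Y \<omega>))"
proof -
  have "distributed M lborel (\<lambda>\<omega>. frac (Y \<omega>)) (indicator {0..<1})"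
    using assms by (intro distributed_frac_uniform)
  moreover from this have "\<forall>b>1. prob_space.benford M b (\<lambda>\<omega>. b powr Y \<omega>)"
    using assms by (blast intro: benford_powr)
  moreover have "ennreal (indicator {0..<1} x / measure lborel {0..<1::real}) = indicator {0..<1} x"
    for x :: real
    by (simp add: ennreal_indicator)
  ultimately show ?thesis by simp
qed

end
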